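(* Let $r \geq 2$ be an integer and let $H = (V,E)$ be an $r$-uniform hypergraph. Then: \begin{enumerate} \item[(1)] $\vartheta^\circ(H,w) = \max\{ w^{\mathsf T} g : g \in \mathrm{TH}^\circ(H)\}$ for every $w \in \mathbb{R}_+^V$; \item[(2)] $\vartheta(H,l)\,\vartheta^\circ(\overline{H},w) \geq l^{\mathsf T} w$ for every $l, w \in \mathbb{R}_+^V$; \item[(3)] $A(\mathrm{TH}(H)) = \mathrm{TH}^\circ(\overline{H})$. \end{enumerate}
   Context: For an integer $r \geq 1$, an $r$-uniform hypergraph $H=(V,E)$ consists of a finite set $V$ and a set $E \subseteq \binom{V}{r}$, where $\binom{V}{r}$ is the set of $r$-element subsets of $V$. The complement $\overline{H}$ is $(V, \binom{V}{r}\setminus E)$. A set $I \subseteq V$ is independent in $H$ if no edge of $H$ is contained in $I$. $\mathrm{IND}(H) = \mathrm{conv}\{\chi_I \in \mathbb{R}^V : I \subseteq V \text{ independent}\}$, where $\chi_I$ is the characteristic function of $I$. For $r \geq 2$ and $x \in V$, the link of $x$ in $H$ is the $(r-1)$-uniform hypergraph $H_x$ with vertex set $V_x = \{ y \in V \setminus\{x\} : \text{there is } e \in E \text{ containing } x \text{ and } y\}$, in which an $(r-1)$-subset $e$ of $V_x$ is an edge if and only if $e \cup \{x\} \in E$. For $A \in \mathbb{R}^{V\times V}$, $A_x \in \mathbb{R}^V$ is the row indexed by $x$; $f[U]$ is the restriction of $f$ to $U \subseteq V$. Positive semidefinite matrices are always symmetric. For a number $\lambda$ and a symmetric matrix $A$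 with diagonal $a$, write $R(\lambda, A) = \begin{pmatrix} \lambda & a^{\mathsf T} \\ a & A\end{pmatrix}$ and $R(A) = R(1,A)$. The theta body $\mathrm{TH}(H)$ is defined recursively. For $r = 1$, $\mathrm{TH}(H) = \mathrm{IND}(H)$. For $r \geq 2$, $\mathrm{TH}(H)$ is the set of all $f \in \mathbb{R}^V$ for which there is $F \in \mathbb{R}^{V \times V}$ such that $f = \mathrm{diag}\,F$, $F_x[V_x] \in F(x,x)\,\mathrm{TH}(H_x)$ for every $x \in V$ (no constraint is imposed on row $F_x$ if the link $H_x$ is empty), and $R(F)$ is positive semidefinite. The theta number is $\vartheta(H,w) = \max\{ w^{\mathsf T} f : f \in \mathrm{TH}(H)\}$. For $r\ge 2$ and $w \in \mathbb{R}_+^V$, $\vartheta^\circ(H,w)$ is the optimal (minimum) value of $\lambda$ over all pairs $(\lambda, Z)$ with $\lambda \in \mathbb{R}$, $Z \in \mathbb{R}^{V\times V}$, $\mathrm{diag}\,Z = w$, $Z_x[\overline{V}_x] \in Z(x,x)\,\mathrm{TH}(\overline{H}_x)$ for all $x \in V$, and $R(\lambda,Z)$ positive semidefinite, where $\overline{H}_x$ is the link of $x$ in $\overline{H}$ and $\overline{V}_x$ is its vertex set (again no constraint if this link is empty). Further, $\mathrm{TH}^\circ(H) = \{ g \in \mathbb{R}_+^V : w^{\mathsf T} g \leq \vartheta^\circ(H,w) \text{ for all } w \in \mathbb{R}_+^V\}$. A convex set $K \subseteq \mathbb{R}^n$ is of antiblocking type if $\emptyset \neq K \subseteq \mathbb{R}_+^n$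 and $x \in K$, $0 \leq y \leq x$ imply $y \in K$. Its antiblocker is $A(K) = \{ x \in \mathbb{R}_+^n : x^{\mathsf T} y \leq 1 \text{ for all } y \in K\}$. ($\mathrm{TH}(H)$ is a convex set of antiblocking type.) *)

theory Defs
  imports "HOL-Analysis.Analysis" "HOL-Library.Ramsey"
begin

text \<open>The vertex set of a hypergraph is an arbitrary (possibly empty) subset of the underlying
  type, because links live on smaller vertex sets. In the analytic part the type is finite, and the
  space of real vectors indexed by a subset \<open>V\<close> is the coordinate subspace of vectors
  vanishing outside \<open>V\<close>; similarly for matrices.\<close>

type_synonym 'v hypergraph = "'v set \<times> 'v set set"

abbreviation verts :: "'v hypergraph \<Rightarrow> 'v set" where "verts H \<equiv> fst H"
abbreviation edges :: "'v hypergraph \<Rightarrow> 'v set set" where "edges H \<equiv> snd H"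

definition uniform_hypergraph :: "nat \<Rightarrow> 'v hypergraph \<Rightarrow> bool" where
  "uniform_hypergraph r H \<longleftrightarrow> finite (verts H) \<and> edges H \<subseteq> nsets (verts H) r"

definition complement_hg :: "nat \<Rightarrow> 'v hypergraph \<Rightarrow> 'v hypergraph" where
  "complement_hg r H = (verts H, nsets (verts H) r - edges H)"

definition independent_set :: "'v hypergraph \<Rightarrow> 'v set \<Rightarrow> bool" where
  "independent_set H I \<longleftrightarrow> I \<subseteq> verts H \<and> (\<forall>e\<in>edges H. \<not> e \<subseteq> I)"

definition link_verts :: "'v hypergraph \<Rightarrow> 'v \<Rightarrow> 'v set" where
  "link_verts H x = {y \<in> verts H - {x}. \<exists>e\<in>edges H. x \<in> e \<and> y \<in> e}"

definition link :: "nat \<Rightarrow> 'v hypergraph \<Rightarrow> 'v \<Rightarrow> 'v hypergraph" where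
  "link r H x = (link_verts H x, {e \<in> nsets (link_verts H x) (r - 1). e \<union> {x} \<in> edges H})"

definition vecs_on :: "'v set \<Rightarrow> (real ^ 'v::finite) set" where
  "vecs_on V = {f. \<forall>x. x \<notin> V \<longrightarrow> f $ x = 0}"

definition nonneg_on :: "'v set \<Rightarrow> (real ^ 'v::finite) set" where
  "nonneg_on V = {f \<in> vecs_on V. \<forall>x\<in>V. 0 \<le> f $ x}"

definition mats_on :: "'v set \<Rightarrow> (real ^ 'v ^ 'v::finite) set" where
  "mats_on V = {A. \<forall>x y. x \<notin> V \<or> y \<notin> V \<longrightarrow> A $ x $ y = 0}"

definition restrict_vec :: "real ^ 'v \<Rightarrow> 'v set \<Rightarrow> real ^ 'v::finite" where
  "restrict_vec f U = (\<chi> x. if x \<in> U then f $ x else 0)"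

definition char_vec :: "'v set \<Rightarrow> real ^ 'v::finite" where
  "char_vec I = (\<chi> x. if x \<in> I then 1 else 0)"

definition diag_vec :: "real ^ 'v ^ 'v \<Rightarrow> real ^ 'v::finite" where
  "diag_vec A = (\<chi> x. A $ x $ x)"

definition psd :: "real ^ 'n ^ 'n::finite \<Rightarrow> bool" where
  "psd A \<longleftrightarrow> transpose A = A \<and> (\<forall>u. 0 \<le> u \<bullet> (A *v u))"

text \<open>The bordered matrix is indexed by \<open>'v option\<close>, with \<open>None\<close> as the extra index. If \<open>A\<close> vanishes
  outside \<open>V \<times> V\<close>, the rows and columns of the result at indices outside \<open>V\<close> vanish as well, so
  they do not affect positive semidefiniteness.\<close>

definition bordered :: "real \<Rightarrow> real ^ 'v ^ 'v \<Rightarrow> real ^ 'v option ^ 'v::finite option" where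
  "bordered l A = (\<chi> i j.
     case i of
       None \<Rightarrow> (case j of None \<Rightarrow> l | Some y \<Rightarrow> diag_vec A $ y)
     | Some x \<Rightarrow> (case j of None \<Rightarrow> diag_vec A $ x | Some y \<Rightarrow> A $ x $ y))"

definition IND :: "'v hypergraph \<Rightarrow> (real ^ 'v::finite) set" where
  "IND H = convex hull (char_vec ` {I. independent_set H I})"

text \<open>The first argument is the uniformity; the value at uniformity \<open>0\<close> is unspecified.\<close>

fun theta_body :: "nat \<Rightarrow> 'v hypergraph \<Rightarrow> (real ^ 'v::finite) set" where
  "theta_body (Suc 0) H = IND H"
| "theta_body (Suc (Suc r)) H =
     {f \<in> vecs_on (verts H). \<exists>F \<in> mats_on (verts H).
        f = diag_vec F \<and>
        (\<forall>x \<in> verts H. link_verts H x \<noteq> {} \<longrightarrow>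
           restrict_vec (F $ x) (link_verts H x)
             \<in> (*\<^sub>R) (F $ x $ x) ` theta_body (Suc r) (link (Suc (Suc r)) H x)) \<and>
        psd (bordered 1 F)}"

definition theta_number :: "nat \<Rightarrow> 'v hypergraph \<Rightarrow> real ^ 'v::finite \<Rightarrow> real" where
  "theta_number r H w = (GREATEST t. t \<in> (\<lambda>f. w \<bullet> f) ` theta_body r H)"

definition theta_circ_feasible ::
  "nat \<Rightarrow> 'v hypergraph \<Rightarrow> real ^ 'v::finite \<Rightarrow> real \<Rightarrow> real ^ 'v ^ 'v \<Rightarrow> bool" where
  "theta_circ_feasible r H w l Z \<longleftrightarrow>
     Z \<in> mats_on (verts H) \<and>
     diag_vec Z = w \<and>
     (\<forall>x \<in> verts H. link_verts (complement_hg r H) x \<noteq> {} \<longrightarrow>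
        restrict_vec (Z $ x) (link_verts (complement_hg r H) x)
          \<in> (*\<^sub>R) (Z $ x $ x) ` theta_body (r - 1) (link r (complement_hg r H) x)) \<and>
     psd (bordered l Z)"

definition theta_circ :: "nat \<Rightarrow> 'v hypergraph \<Rightarrow> real ^ 'v::finite \<Rightarrow> real" where
  "theta_circ r H w = (LEAST l. \<exists>Z. theta_circ_feasible r H w l Z)"

definition theta_circ_body :: "nat \<Rightarrow> 'v hypergraph \<Rightarrow> (real ^ 'v::finite) set" where
  "theta_circ_body r H =
     {g \<in> nonneg_on (verts H). \<forall>w \<in> nonneg_on (verts H). w \<bullet> g \<le> theta_circ r H w}"

definition antiblocker :: "'v set \<Rightarrow> (real ^ 'v::finite) set \<Rightarrow> (real ^ 'v) set" where
  "antiblocker V K = {x \<in> nonneg_on V. \<forall>y\<in>K. x \<bullet> y \<le> 1}"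

end

theory Submission
  imports Defs
begin

text \<open>
  The optimisation problem for \<open>theta_circ r (complement_hg r H) w\<close> constrains the rows of its
  matrix by the links of the complement of the complement, that is, by the links of \<open>H\<close>. These
  row constraints are invariant under scaling the matrix, and \<open>bordered l (l *\<^sub>R F)\<close> equals
  \<open>l *\<^sub>R bordered 1 F\<close>. So a matrix that is feasible with value \<open>l > 0\<close> is \<open>l\<close> times a matrix
  witnessing a point of \<open>theta_body r H\<close>, and
  \<open>theta_circ r (complement_hg r H) w\<close> is the least \<open>l \<ge> 0\<close> such that \<open>w\<close> lies in
  \<open>l\<close> times \<open>theta_body r H\<close>. In other words, it is the Minkowski gauge of the theta body
  (\<open>theta_circ_eq_gauge\<close>).

  Given this, all three claims are antiblocking duality for a convex body \<open>K\<close>: the theta body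
  of \<open>H\<close>, or of its complement in the first claim. The
  vectors \<open>g \<ge> 0\<close> with \<open>w \<bullet> g \<le> gauge w\<close> for all \<open>w \<ge> 0\<close> form the antiblocker of \<open>K\<close>, because
  \<open>w = gauge w *\<^sub>R f\<close> with \<open>f \<in> K\<close> (\<open>antiblocker_eq_gauge_polar\<close>). The same decomposition gives
  \<open>l \<bullet> w = gauge w * (l \<bullet> f)\<close>, hence the product inequality, since
  \<open>l \<bullet> f \<le> theta_number r H l\<close>. Finally, the gauge of \<open>K\<close> is the support
  function of the antiblocker of \<open>K\<close>, by separating from \<open>K\<close> the points that are too long to
  belong to it (\<open>gauge_attained_on_antiblocker\<close>).

  What remains is to show that theta bodies are compact and convex, lie in the nonnegative
  orthant and are closed under setting coordinates to zero. This goes by induction on the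
  uniformity: the passage from the bodies of all links to the body of the hypergraph preserves
  these properties (\<open>corner_body_lift_body\<close>). From uniformity two on, the body also contains
  the unit vectors, which makes its gauge finite.
\<close>

section \<open>Corner bodies and their antiblockers\<close>

text \<open>For a convex subset of the orthant, being closed under setting coordinates to zero is
  equivalent to being closed downwards, since lowering one coordinate is a convex combination of
  keeping it and erasing it. The erasing form is the one that passes easily to convex hulls of
  characteristic vectors and to matrices, where it is the passage to a principal submatrix.\<close>

definition corner_body :: "'v set \<Rightarrow> (real ^ 'v::finite) set \<Rightarrow> bool" where
  "corner_body V K \<longleftrightarrow> compact K \<and> convex K \<and> K \<subseteq> nonneg_on V \<and> 0 \<in> K \<and>
     (\<forall>f\<in>K. \<forall>U. restrict_vec f U \<in> K)"

definition minkowski_gauge :: "'a::real_vector set \<Rightarrow> 'a \<Rightarrow> real" where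
  "minkowski_gauge K w = (LEAST l. 0 \<le> l \<and> w \<in> (*\<^sub>R) l ` K)"

text \<open>For \<open>t = 0\<close> the scaled set \<open>t *\<^sub>R K\<close> collapses to the origin, and the pairs \<open>(t, f)\<close> with
  \<open>f\<close> in \<open>t *\<^sub>R K\<close> still form a closed set, because they are a continuous image of an interval
  times \<open>K\<close>. This gives both attained gauges and closed row constraints.\<close>

lemma scaled_points_compact:
  fixes K :: "'a::real_normed_vector set"
  assumes "compact K"
  shows "compact {(t, f). 0 \<le> t \<and> t \<le> M \<and> f \<in> (*\<^sub>R) t ` K}"
proof -
  have "{(t, f). 0 \<le> t \<and> t \<le> M \<and> f \<in> (*\<^sub>R) t ` K} =
      (\<lambda>(t, f). (t, t *\<^sub>R f)) ` ({0..M} \<times> K)"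
    by auto
  moreover have "compact ((\<lambda>(t, f). (t, t *\<^sub>R f)) ` ({0..M} \<times> K))"
    unfolding case_prod_beta
    by (intro compact_continuous_image continuous_intros compact_Times assms compact_Icc)
  ultimately show ?thesis by simp
qed

lemma scaled_convex_add:
  fixes K :: "'a::real_vector set"
  assumes "convex K" "K \<noteq> {}" "0 \<le> s" "0 \<le> t" "f \<in> (*\<^sub>R) s ` K" "g \<in> (*\<^sub>R) t ` K"
  shows "f + g \<in> (*\<^sub>R) (s + t) ` K"
proof (cases "s + t = 0")
  case True
  then have "s = 0" "t = 0" using assms by auto
  then show ?thesis using assms by auto
next
  case False
  obtain a b where ab: "a \<in> K" "b \<in> K" "f = s *\<^sub>R a" "g = t *\<^sub>R b" using assms by auto
  have "(s / (s + t)) *\<^sub>R a + (t / (s + t)) *\<^sub>R b \<in> K"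
    using assms ab False by (intro convexD) (auto simp: add_divide_distrib[symmetric])
  moreover have "f + g = (s + t) *\<^sub>R ((s / (s + t)) *\<^sub>R a + (t / (s + t)) *\<^sub>R b)"
    using False ab by (simp add: scaleR_add_right)
  ultimately show ?thesis by blast
qed

lemma nonneg_on_nth: "f \<in> nonneg_on V \<Longrightarrow> 0 \<le> f $ x"
  by (cases "x \<in> V") (auto simp: nonneg_on_def vecs_on_def)

lemma inner_nonneg_on: "f \<in> nonneg_on V \<Longrightarrow> g \<in> nonneg_on V \<Longrightarrow> 0 \<le> f \<bullet> g"
  unfolding inner_vec_def by (auto intro!: sum_nonneg simp: nonneg_on_nth)

text \<open>A nonnegative vector is a conic combination of unit vectors, and their coefficients add up;
  so gauges are finite as soon as the body contains the unit vectors.\<close>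

lemma nonneg_on_in_scaled:
  assumes K: "corner_body V K" and ax: "\<And>x. x \<in> V \<Longrightarrow> axis x 1 \<in> K"
    and w: "w \<in> nonneg_on V"
  shows "w \<in> (*\<^sub>R) (\<Sum>x\<in>UNIV. w $ x) ` K"
proof -
  have K': "convex K" "0 \<in> K" "K \<noteq> {}" using K unfolding corner_body_def by auto
  have scl: "w $ x *\<^sub>R axis x 1 \<in> (*\<^sub>R) (w $ x) ` K" for x
  proof (cases "x \<in> V")
    case False
    then have "w $ x = 0" using w by (auto simp: nonneg_on_def vecs_on_def)
    then show ?thesis using K' by auto
  qed (use ax in auto)
  have "(\<Sum>x\<in>S. w $ x *\<^sub>R axis x 1) \<in> (*\<^sub>R) (\<Sum>x\<in>S. w $ x) ` K" if "finite S" for S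
    using that
  proof induction
    case empty
    then show ?case using K' by auto
  next
    case (insert x S)
    then show ?case
      using scaled_convex_add[OF K'(1,3) _ _ scl insert.IH] w
      by (simp add: nonneg_on_nth sum_nonneg)
  qed
  moreover have "(\<Sum>x\<in>UNIV. w $ x *\<^sub>R axis x 1) = w"
    using basis_expansion[of w] by (simp add: scalar_mult_eq_scaleR)
  ultimately show ?thesis by (metis finite)
qed

lemma minkowski_gauge_least:
  assumes K: "corner_body V K" and ax: "\<And>x. x \<in> V \<Longrightarrow> axis x 1 \<in> K"
    and w: "w \<in> nonneg_on V"
  shows "0 \<le> minkowski_gauge K w" "w \<in> (*\<^sub>R) (minkowski_gauge K w) ` K"
    and "\<And>l. 0 \<le> l \<Longrightarrow> w \<in> (*\<^sub>R) l ` K \<Longrightarrow> minkowski_gauge K w \<le> l"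
proof -
  define P where "P l \<longleftrightarrow> 0 \<le> l \<and> w \<in> (*\<^sub>R) l ` K" for l
  define M where "M = (\<Sum>x\<in>UNIV. w $ x)"
  have PM: "P M"
    unfolding P_def M_def using nonneg_on_in_scaled[OF K ax w] w
    by (auto intro: sum_nonneg simp: nonneg_on_nth)
  have "compact K" using K by (simp add: corner_body_def)
  then have "compact ({(t, f). 0 \<le> t \<and> t \<le> M \<and> f \<in> (*\<^sub>R) t ` K} \<inter> UNIV \<times> {w})"
    by (intro compact_Int_closed scaled_points_compact closed_Times) auto
  then have "compact (fst ` ({(t, f). 0 \<le> t \<and> t \<le> M \<and> f \<in> (*\<^sub>R) t ` K} \<inter> UNIV \<times> {w}))"
    by (intro compact_continuous_image continuous_intros)
  moreover have "fst ` ({(t, f). 0 \<le> t \<and> t \<le> M \<and> f \<in> (*\<^sub>R) t ` K} \<inter> UNIV \<times> {w})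
      = {l. P l \<and> l \<le> M}"
    unfolding P_def by force
  \<comment> \<open>Cutting off at the known feasible value \<open>M\<close> does not change the minimum.\<close>
  ultimately have "compact {l. P l \<and> l \<le> M}" by simp
  then obtain m where m: "P m" "m \<le> M" "\<And>l. P l \<Longrightarrow> l \<le> M \<Longrightarrow> m \<le> l"
    using compact_attains_inf[of "{l. P l \<and> l \<le> M}"] PM by blast
  have least: "m \<le> l" if "P l" for l using m that by (cases "l \<le> M") auto
  have "minkowski_gauge K w = m"
    unfolding minkowski_gauge_def P_def[symmetric] by (rule Least_equality) (use m least in auto)
  then show "0 \<le> minkowski_gauge K w" "w \<in> (*\<^sub>R) (minkowski_gauge K w) ` K"
    and "\<And>l. 0 \<le> l \<Longrightarrow> w \<in> (*\<^sub>R) l ` K \<Longrightarrow> minkowski_gauge K w \<le> l"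
    using m(1) least by (auto simp: P_def)
qed

lemma antiblocker_eq_gauge_polar:
  assumes K: "corner_body V K" and ax: "\<And>x. x \<in> V \<Longrightarrow> axis x 1 \<in> K"
  shows "antiblocker V K = {g \<in> nonneg_on V. \<forall>w\<in>nonneg_on V. w \<bullet> g \<le> minkowski_gauge K w}"
proof (intro subset_antisym subsetI)
  fix g assume g: "g \<in> antiblocker V K"
  have "w \<bullet> g \<le> minkowski_gauge K w" if w: "w \<in> nonneg_on V" for w
  proof -
    note gw = minkowski_gauge_least[OF K ax w]
    obtain f where f: "f \<in> K" "w = minkowski_gauge K w *\<^sub>R f" using gw(2) by auto
    have "w \<bullet> g = minkowski_gauge K w * (g \<bullet> f)"
      by (subst f(2)) (simp add: inner_commute)
    also have "\<dots> \<le> minkowski_gauge K w * 1"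
      using g f gw(1) by (intro mult_left_mono) (auto simp: antiblocker_def)
    finally show ?thesis by simp
  qed
  then show "g \<in> {g \<in> nonneg_on V. \<forall>w\<in>nonneg_on V. w \<bullet> g \<le> minkowski_gauge K w}"
    using g by (auto simp: antiblocker_def)
next
  fix g assume g: "g \<in> {g \<in> nonneg_on V. \<forall>w\<in>nonneg_on V. w \<bullet> g \<le> minkowski_gauge K w}"
  have "g \<bullet> y \<le> 1" if "y \<in> K" for y
  proof -
    have y: "y \<in> nonneg_on V" using K that by (auto simp: corner_body_def)
    have "minkowski_gauge K y \<le> 1"
      using minkowski_gauge_least(3)[OF K ax y, of 1] that by auto
    then show ?thesis using g y by (force simp: inner_commute)
  qed
  then show "g \<in> antiblocker V K" using g by (auto simp: antiblocker_def)
qed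

text \<open>Unit vectors in \<open>K\<close> bound every coordinate of an antiblocking vector by one.\<close>

lemma compact_antiblocker:
  assumes K: "corner_body V K" and ax: "\<And>x. x \<in> V \<Longrightarrow> axis x 1 \<in> K"
  shows "compact (antiblocker V K)"
proof -
  have "closed (antiblocker V K)"
  proof -
    have "antiblocker V K = {g. (\<forall>x. x \<notin> V \<longrightarrow> g $ x = 0) \<and> (\<forall>x. x \<in> V \<longrightarrow> 0 \<le> g $ x) \<and>
        (\<forall>y. y \<in> K \<longrightarrow> g \<bullet> y \<le> 1)}"
      by (auto simp: antiblocker_def nonneg_on_def vecs_on_def)
    then show ?thesis
      by (simp only:) (intro closed_Collect_conj closed_Collect_all closed_Collect_imp
          closed_Collect_eq closed_Collect_le continuous_intros open_Collect_const)
  qed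
  moreover have "bounded (antiblocker V K)"
  proof (rule boundedI)
    fix g assume g: "g \<in> antiblocker V K"
    have "\<bar>g $ x\<bar> \<le> 1" for x
    proof (cases "x \<in> V")
      case True
      then have "g \<bullet> axis x 1 \<le> 1" using g ax by (auto simp: antiblocker_def)
      then show ?thesis using g nonneg_on_nth[of g V x] by (auto simp: antiblocker_def inner_axis)
    next
      case False
      then show ?thesis using g by (auto simp: antiblocker_def nonneg_on_def vecs_on_def)
    qed
    then have "(\<Sum>x\<in>UNIV. \<bar>g $ x\<bar>) \<le> (\<Sum>x\<in>(UNIV::'a set). 1)" by (intro sum_mono)
    then show "norm g \<le> (\<Sum>x\<in>(UNIV::'a set). 1)"
      using norm_le_l1_cart[of g] by linarith
  qed
  ultimately show ?thesis by (simp add: compact_eq_bounded_closed)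
qed

text \<open>A separating functional has arbitrary signs, but its part of the wrong sign can be dropped.
  On \<open>K\<close> the truncated functional takes values that the full one takes at points with
  erased coordinates, which are again in \<open>K\<close>; at the nonnegative point \<open>z\<close> truncation only
  helps.\<close>

lemma antiblocker_separates:
  assumes K: "corner_body V K" and z: "z \<in> nonneg_on V" "z \<notin> K"
  shows "\<exists>g\<in>antiblocker V K. 1 < g \<bullet> z"
proof -
  have K': "compact K" "convex K" "0 \<in> K" "K \<subseteq> nonneg_on V"
    "\<And>f U. f \<in> K \<Longrightarrow> restrict_vec f U \<in> K"
    using K unfolding corner_body_def by auto
  obtain a b where ab: "a \<bullet> z < b" "\<And>f. f \<in> K \<Longrightarrow> b < a \<bullet> f"
    using separating_hyperplane_closed_point[of K z] K' z compact_imp_closed by blast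
  have b: "b < 0" using ab(2)[OF K'(3)] by simp
  \<comment> \<open>The functional \<open>a\<close> lies above \<open>b < 0\<close> on \<open>K\<close>, so division by \<open>b\<close> normalises it and turns
    its negative coordinates into the positive ones.\<close>
  define U where "U = {x \<in> V. a $ x < 0}"
  define g where "g = (1 / b) *\<^sub>R restrict_vec a U"
  have "g \<in> nonneg_on V"
    using b by (auto simp: g_def U_def nonneg_on_def vecs_on_def restrict_vec_def divide_nonpos_neg
        intro: divide_nonpos_neg)
  moreover have "g \<bullet> f \<le> 1" if "f \<in> K" for f
  proof -
    have "restrict_vec a U \<bullet> f = a \<bullet> restrict_vec f U"
      unfolding inner_vec_def by (intro sum.cong) (auto simp: restrict_vec_def)
    moreover have "b < a \<bullet> restrict_vec f U" using ab K' that by blast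
    ultimately show ?thesis using b by (simp add: g_def divide_simps)
  qed
  moreover have "1 < g \<bullet> z"
  proof -
    have "restrict_vec a U \<bullet> z \<le> a \<bullet> z"
      unfolding inner_vec_def
    proof (rule sum_mono)
      fix x
      show "restrict_vec a U $ x \<bullet> z $ x \<le> a $ x \<bullet> z $ x"
      proof (cases "x \<in> V")
        case True
        then show ?thesis using nonneg_on_nth[OF z(1), of x] by (auto simp: restrict_vec_def U_def)
      next
        case False
        then show ?thesis using z by (auto simp: nonneg_on_def vecs_on_def)
      qed
    qed
    then have "restrict_vec a U \<bullet> z < b" using ab by linarith
    then show ?thesis using b by (simp add: g_def divide_simps)
  qed
  ultimately show ?thesis by (auto simp: antiblocker_def)
qed

text \<open>If every antiblocking vector had a smaller product with \<open>w\<close> than the gauge of \<open>w\<close>, then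
  a value \<open>m\<close> strictly in between would give a point \<open>w / m\<close> outside \<open>K\<close> that no
  antiblocking vector separates from \<open>K\<close>.\<close>

lemma gauge_attained_on_antiblocker:
  assumes K: "corner_body V K" and ax: "\<And>x. x \<in> V \<Longrightarrow> axis x 1 \<in> K"
    and w: "w \<in> nonneg_on V"
  shows "\<exists>g\<in>antiblocker V K. minkowski_gauge K w = w \<bullet> g"
proof -
  note gw = minkowski_gauge_least[OF K ax w]
  have "0 \<in> antiblocker V K" by (auto simp: antiblocker_def nonneg_on_def vecs_on_def)
  then have "antiblocker V K \<noteq> {}" by blast
  moreover have "continuous_on (antiblocker V K) (\<lambda>g. w \<bullet> g)" by (intro continuous_intros)
  ultimately obtain g
    where g: "g \<in> antiblocker V K" "\<And>h. h \<in> antiblocker V K \<Longrightarrow> w \<bullet> h \<le> w \<bullet> g"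
    using continuous_attains_sup[OF compact_antiblocker[OF K ax]] by blast
  have le: "w \<bullet> g \<le> minkowski_gauge K w"
    using g(1) w antiblocker_eq_gauge_polar[OF K ax] by auto
  have wg: "0 \<le> w \<bullet> g" using g(1) w by (auto simp: antiblocker_def intro: inner_nonneg_on)
  have "minkowski_gauge K w \<le> w \<bullet> g"
  proof (rule ccontr)
    assume "\<not> ?thesis"
    then obtain m where m: "w \<bullet> g < m" "m < minkowski_gauge K w" using dense by (meson not_le)
    have m0: "0 < m" using m wg by linarith
    have "(1 / m) *\<^sub>R w \<notin> K"
    proof
      assume "(1 / m) *\<^sub>R w \<in> K"
      moreover have "w = m *\<^sub>R ((1 / m) *\<^sub>R w)" using m0 by simp
      ultimately have "w \<in> (*\<^sub>R) m ` K" by blast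
      then show False using gw(3)[of m] m m0 by auto
    qed
    moreover have "(1 / m) *\<^sub>R w \<in> nonneg_on V"
      using w m0 by (auto simp: nonneg_on_def vecs_on_def)
    ultimately obtain h where h: "h \<in> antiblocker V K" "1 < h \<bullet> ((1 / m) *\<^sub>R w)"
      using antiblocker_separates[OF K] by blast
    then have "m < w \<bullet> h" using m0 by (simp add: divide_simps inner_commute)
    then show False using g(2)[OF h(1)] m by linarith
  qed
  with le g(1) show ?thesis by (auto intro!: bexI[of _ g])
qed

section \<open>Positive semidefinite matrices\<close>

lemma quadratic_form_sum:
  "u \<bullet> (A *v u) = (\<Sum>i\<in>UNIV. \<Sum>j\<in>UNIV. u $ i * (A $ i $ j * u $ j))"
  for u :: "real ^ 'n::finite"
  by (simp add: inner_vec_def matrix_vector_mult_def sum_distrib_left)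

text \<open>The quadratic form at a vector supported on two indices; the entrywise bounds for bordered
  matrices all come from suitable choices of \<open>s\<close> and \<open>t\<close>.\<close>

lemma psd_pair:
  assumes "psd A"
  shows "0 \<le> s\<^sup>2 * A $ i $ i + 2 * s * t * A $ i $ j + t\<^sup>2 * A $ j $ j"
proof -
  have "transpose A $ i $ j = A $ i $ j" using assms by (simp add: psd_def)
  then have sym: "A $ j $ i = A $ i $ j" by (simp add: transpose_def)
  have ax: "axis a 1 \<bullet> (A *v axis b 1) = A $ a $ b" for a b
    by (simp add: inner_axis' matrix_vector_mult_basis column_def)
  have "0 \<le> (s *\<^sub>R axis i 1 + t *\<^sub>R axis j 1) \<bullet> (A *v (s *\<^sub>R axis i 1 + t *\<^sub>R axis j 1))"
    using assms by (auto simp: psd_def)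
  also have "\<dots> = s\<^sup>2 * A $ i $ i + 2 * s * t * A $ i $ j + t\<^sup>2 * A $ j $ j"
    by (simp add: matrix_vector_right_distrib matrix_vector_mult_scaleR inner_add_left
        inner_add_right ax sym power2_eq_square algebra_simps)
  finally show ?thesis .
qed

lemma psd_scaleR: "psd A \<Longrightarrow> 0 \<le> c \<Longrightarrow> psd (c *\<^sub>R A)"
  by (auto simp: psd_def transpose_scalar scaleR_matrix_vector_assoc[symmetric])

lemma psd_add: "psd A \<Longrightarrow> psd B \<Longrightarrow> psd (A + B)"
  unfolding psd_def
  by (auto simp: matrix_vector_mult_add_rdistrib inner_add_right transpose_def vec_eq_iff)

lemma closed_psd: "closed {A :: real ^ 'n ^ 'n::finite. psd A}"
proof -
  have "{A :: real ^ 'n ^ 'n. psd A} = {A. (\<forall>i j. A $ j $ i = A $ i $ j) \<and>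
      (\<forall>u. 0 \<le> (\<Sum>i\<in>UNIV. \<Sum>j\<in>UNIV. u $ i * (A $ i $ j * u $ j)))}"
    by (auto simp: psd_def transpose_def vec_eq_iff quadratic_form_sum)
  moreover have "closed \<dots>"
    by (intro closed_Collect_conj closed_Collect_all closed_Collect_eq
        closed_Collect_le continuous_intros)
  ultimately show ?thesis by (simp only:)
qed

definition principal_part :: "'n set \<Rightarrow> real ^ 'n ^ 'n \<Rightarrow> real ^ 'n ^ 'n::finite" where
  "principal_part S A = (\<chi> i j. if i \<in> S \<and> j \<in> S then A $ i $ j else 0)"

lemma psd_principal_part:
  assumes "psd A"
  shows "psd (principal_part S A)"
proof -
  have "u \<bullet> (principal_part S A *v u) = restrict_vec u S \<bullet> (A *v restrict_vec u S)" for u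
    unfolding quadratic_form_sum
    by (intro sum.cong refl) (auto simp: principal_part_def restrict_vec_def)
  then show ?thesis
    using assms by (auto simp: psd_def principal_part_def transpose_def vec_eq_iff)
qed

lemma bordered_combination:
  "bordered (u * l + v * m) (u *\<^sub>R A + v *\<^sub>R B) = u *\<^sub>R bordered l A + v *\<^sub>R bordered m B"
  by (auto simp: bordered_def diag_vec_def vec_eq_iff split: option.split)

lemma bordered_scaleR: "bordered (c * l) (c *\<^sub>R A) = c *\<^sub>R bordered l A"
  using bordered_combination[of c l 0 0 A 0] by simp

lemma continuous_on_bordered: "continuous_on S (bordered l)"
proof -
  have "continuous_on S (\<lambda>A. bordered l A $ i $ j)" for i j
    by (cases i; cases j) (auto simp: bordered_def diag_vec_def intro!: continuous_intros)
  then have "continuous_on S (\<lambda>A. \<chi> i j. bordered l A $ i $ j)"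
    by (intro continuous_on_vec_lambda)
  then show ?thesis by simp
qed

lemma bordered_principal_part:
  "bordered 1 (principal_part U F) = principal_part (insert None (Some ` U)) (bordered 1 F)"
  by (auto simp: bordered_def diag_vec_def principal_part_def vec_eq_iff split: option.split)

text \<open>Pairing the border with a diagonal index gives the \<open>2 \<times> 2\<close> block with rows \<open>(l, a)\<close> and
  \<open>(a, a)\<close>, where \<open>a\<close> is the diagonal entry. It forces \<open>0 \<le> a \<le> l\<close>; hence the matrices
  with border \<open>1\<close> are bounded, and border \<open>0\<close> leaves only the zero diagonal.\<close>

lemma psd_bordered_bounds:
  assumes "psd (bordered l A)"
  shows "0 \<le> l" "0 \<le> A $ x $ x" "l = 0 \<Longrightarrow> A $ x $ x = 0" "l = 1 \<Longrightarrow> \<bar>A $ x $ y\<bar> \<le> 1"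
proof -
  have corner: "0 \<le> s\<^sup>2 * l + 2 * s * t * A $ x $ x + t\<^sup>2 * A $ x $ x" for s t x
    using psd_pair[OF assms, of s None t "Some x"] by (simp add: bordered_def diag_vec_def)
  have inner: "0 \<le> s\<^sup>2 * A $ x $ x + 2 * s * t * A $ x $ y + t\<^sup>2 * A $ y $ y" for s t x y
    using psd_pair[OF assms, of s "Some x" t "Some y"] by (simp add: bordered_def diag_vec_def)
  show "0 \<le> l" using corner[of 1 0] by simp
  show nn: "0 \<le> A $ x $ x" for x using corner[of 0 1 x] by simp
  show "A $ x $ x = 0" if "l = 0" using corner[of "- 1" 1 x] nn[of x] that by simp
  show "\<bar>A $ x $ y\<bar> \<le> 1" if "l = 1"
  proof -
    have "A $ z $ z \<le> 1" for z
    proof -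
      have "(A $ z $ z)\<^sup>2 \<le> A $ z $ z"
        using corner[of "- (A $ z $ z)" 1 z] that by (simp add: power2_eq_square)
      then show ?thesis
        using mult_strict_left_mono[of 1 "A $ z $ z" "A $ z $ z"] by (fastforce simp: power2_eq_square)
    qed
    from this[of x] this[of y] show ?thesis using inner[of 1 x 1 y] inner[of 1 x "- 1" y] by simp
  qed
qed

section \<open>Lifting corner bodies\<close>

text \<open>One step of the theta recursion with the bodies of the links replaced by arbitrary sets:
  \<open>N x\<close> stands for the vertices of the link of \<open>x\<close>, and \<open>K x\<close> for its body. The set \<open>lifts\<close>
  leaves out the semidefinite constraint, so that it is invariant under scaling and serves
  both the theta body and its dual program.\<close>

definition lifts :: "'v set \<Rightarrow> ('v \<Rightarrow> 'v set) \<Rightarrow> ('v \<Rightarrow> (real ^ 'v) set) \<Rightarrow> (real ^ 'v ^ 'v::finite) set"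
  where "lifts V N K = {F \<in> mats_on V. \<forall>x\<in>V. N x \<noteq> {} \<longrightarrow>
     restrict_vec (F $ x) (N x) \<in> (*\<^sub>R) (F $ x $ x) ` K x}"

definition lift_body :: "'v set \<Rightarrow> ('v \<Rightarrow> 'v set) \<Rightarrow> ('v \<Rightarrow> (real ^ 'v) set) \<Rightarrow> (real ^ 'v::finite) set"
  where "lift_body V N K = diag_vec ` {F \<in> lifts V N K. psd (bordered 1 F)}"

lemma lift_bodyI:
  "F \<in> lifts V N K \<Longrightarrow> psd (bordered 1 F) \<Longrightarrow> diag_vec F = f \<Longrightarrow> f \<in> lift_body V N K"
  by (auto simp: lift_body_def)

lemma linear_diag_vec: "linear diag_vec"
  by (rule linearI) (auto simp: diag_vec_def vec_eq_iff)

lemma restrict_vec_add: "restrict_vec (f + g) U = restrict_vec f U + restrict_vec g U"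
  and restrict_vec_scaleR: "restrict_vec (c *\<^sub>R f) U = c *\<^sub>R restrict_vec f U"
  and restrict_vec_zero: "restrict_vec 0 U = 0"
  and restrict_vec_swap: "restrict_vec (restrict_vec f U) W = restrict_vec (restrict_vec f W) U"
  by (auto simp: restrict_vec_def vec_eq_iff)

lemma lifts_scaleR: "F \<in> lifts V N K \<Longrightarrow> c *\<^sub>R F \<in> lifts V N K"
  by (fastforce simp: lifts_def mats_on_def restrict_vec_scaleR)

lemma lifts_add:
  assumes K: "\<And>x. x \<in> V \<Longrightarrow> convex (K x)"
    and F: "F \<in> lifts V N K" "\<And>x. 0 \<le> F $ x $ x" and G: "G \<in> lifts V N K" "\<And>x. 0 \<le> G $ x $ x"
  shows "F + G \<in> lifts V N K"
  unfolding lifts_def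
proof (intro CollectI conjI ballI impI)
  show "F + G \<in> mats_on V" using F G by (auto simp: lifts_def mats_on_def)
  fix x assume x: "x \<in> V" "N x \<noteq> {}"
  then have "restrict_vec (F $ x) (N x) \<in> (*\<^sub>R) (F $ x $ x) ` K x"
    "restrict_vec (G $ x) (N x) \<in> (*\<^sub>R) (G $ x $ x) ` K x"
    using F G by (auto simp: lifts_def)
  then have "restrict_vec (F $ x) (N x) + restrict_vec (G $ x) (N x)
      \<in> (*\<^sub>R) (F $ x $ x + G $ x $ x) ` K x"
    using K[OF x(1)] F(2) G(2) by (intro scaled_convex_add) auto
  then show "restrict_vec ((F + G) $ x) (N x) \<in> (*\<^sub>R) ((F + G) $ x $ x) ` K x"
    by (simp add: restrict_vec_add)
qed

lemma convex_lift_matrices: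
  assumes K: "\<And>x. x \<in> V \<Longrightarrow> convex (K x)"
  shows "convex {F \<in> lifts V N K. psd (bordered 1 F)}"
proof (rule convexI)
  fix F G and u v :: real
  assume F: "F \<in> {F \<in> lifts V N K. psd (bordered 1 F)}" and G: "G \<in> {F \<in> lifts V N K. psd (bordered 1 F)}"
    and uv: "0 \<le> u" "0 \<le> v" "u + v = 1"
  have "u *\<^sub>R F + v *\<^sub>R G \<in> lifts V N K"
    using F G uv psd_bordered_bounds(2)[of 1] by (intro lifts_add[OF K] lifts_scaleR)
      (auto intro: mult_nonneg_nonneg)
  moreover have "psd (bordered 1 (u *\<^sub>R F + v *\<^sub>R G))"
    using F G uv bordered_combination[of u 1 v 1 F G] by (auto intro: psd_add psd_scaleR)
  ultimately show "u *\<^sub>R F + v *\<^sub>R G \<in> {F \<in> lifts V N K. psd (bordered 1 F)}" by simp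
qed

text \<open>Semidefiniteness confines all diagonal entries to \<open>[0, 1]\<close>, so the condition on the row of
  \<open>x\<close> says that the pair of diagonal entry and restricted row lies in the compact set of scaled
  points of \<open>K x\<close>.\<close>

lemma compact_lift_matrices:
  assumes K: "\<And>x. x \<in> V \<Longrightarrow> compact (K x)"
  shows "compact {F \<in> lifts V N K. psd (bordered 1 F)}"
proof -
  let ?S = "{F \<in> lifts V N K. psd (bordered 1 F)}"
  define C where "C x = {(t, f). 0 \<le> t \<and> t \<le> 1 \<and> f \<in> (*\<^sub>R) t ` K x}" for x
  have "bounded ?S"
  proof (rule boundedI)
    fix F assume F: "F \<in> ?S"
    have row: "norm (F $ x) \<le> (\<Sum>y\<in>(UNIV::'a set). 1)" for x
    proof -
      have "norm (F $ x) \<le> (\<Sum>y\<in>UNIV. \<bar>F $ x $ y\<bar>)" by (rule norm_le_l1_cart)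
      also have "\<dots> \<le> (\<Sum>y\<in>(UNIV::'a set). 1)"
        using F psd_bordered_bounds(4)[of 1 F x] by (intro sum_mono) auto
      finally show ?thesis .
    qed
    have "norm F \<le> (\<Sum>x\<in>UNIV. norm (F $ x))"
      unfolding norm_vec_def by (rule L2_set_le_sum) simp
    also have "\<dots> \<le> (\<Sum>x\<in>(UNIV::'a set). \<Sum>y\<in>(UNIV::'a set). 1)"
      using row by (rule sum_mono)
    finally show "norm F \<le> (\<Sum>x\<in>(UNIV::'a set). \<Sum>y\<in>(UNIV::'a set). 1)" .
  qed
  moreover have "closed ?S"
  proof -
    have "?S = {F. \<forall>x y. x \<notin> V \<or> y \<notin> V \<longrightarrow> F $ x $ y = 0} \<inter> bordered 1 -` {A. psd A} \<inter>
        (\<Inter>x\<in>{x \<in> V. N x \<noteq> {}}. (\<lambda>F. (F $ x $ x, restrict_vec (F $ x) (N x))) -` C x)"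
      (is "_ = ?A \<inter> ?B \<inter> ?D")
    proof (intro subset_antisym subsetI)
      fix F assume F: "F \<in> ?S"
      then have "\<bar>F $ x $ y\<bar> \<le> 1" "0 \<le> F $ x $ x" for x y
        using psd_bordered_bounds[of 1 F] by auto
      then have "F $ x $ x \<le> 1" "0 \<le> F $ x $ x" for x
        by (auto simp: abs_le_iff)
      with F show "F \<in> ?A \<inter> ?B \<inter> ?D"
        unfolding lifts_def mats_on_def C_def by blast
    next
      fix F assume "F \<in> ?A \<inter> ?B \<inter> ?D"
      then show "F \<in> ?S" unfolding lifts_def mats_on_def C_def by blast
    qed
    moreover have "closed ?A"
      by (intro closed_Collect_all closed_Collect_imp closed_Collect_eq continuous_intros
          open_Collect_const)
    moreover have "closed ?B"
      by (intro closed_vimage closed_psd continuous_on_bordered)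
    moreover have "closed ?D"
    proof (intro closed_INT ballI)
      fix x assume "x \<in> {x \<in> V. N x \<noteq> {}}"
      then have "closed (C x)"
        unfolding C_def using K by (intro compact_imp_closed scaled_points_compact) auto
      moreover have "continuous_on UNIV (\<lambda>F. (F $ x $ x, restrict_vec (F $ x) (N x)))"
      proof -
        have "continuous_on UNIV (\<lambda>F::real^'a^'a. if y \<in> N x then F $ x $ y else 0)" for y
          by (cases "y \<in> N x") (auto intro!: continuous_intros)
        then show ?thesis
          unfolding restrict_vec_def by (intro continuous_intros continuous_on_vec_lambda)
      qed
      ultimately show "closed ((\<lambda>F. (F $ x $ x, restrict_vec (F $ x) (N x))) -` C x)"
        by (rule closed_vimage)
    qed
    ultimately show ?thesis by (simp only: closed_Int)
  qed
  ultimately show ?thesis by (simp add: compact_eq_bounded_closed)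
qed

text \<open>Compactness and convexity pass from the witnessing matrices to their diagonals. To erase
  coordinates of the diagonal, erase the corresponding rows and columns: each surviving row stays
  admissible because \<open>K x\<close> is itself closed under erasing, and an erased row is zero times the
  origin.\<close>

lemma corner_body_lift_body:
  assumes K: "\<And>x. x \<in> V \<Longrightarrow> corner_body (N x) (K x)"
  shows "corner_body V (lift_body V N K)"
  unfolding corner_body_def
proof (intro conjI ballI allI)
  have K': "compact (K x)" "convex (K x)" "0 \<in> K x" "\<And>f U. f \<in> K x \<Longrightarrow> restrict_vec f U \<in> K x"
    if "x \<in> V" for x
    using K[OF that] by (auto simp: corner_body_def)
  show "compact (lift_body V N K)"
    unfolding lift_body_def using K'(1)
    by (intro compact_continuous_image compact_lift_matrices linear_continuous_on
        linear_linear[THEN iffD2] linear_diag_vec) auto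
  show "convex (lift_body V N K)"
    unfolding lift_body_def using K'(2)
    by (intro convex_linear_image linear_diag_vec convex_lift_matrices) auto
  show "lift_body V N K \<subseteq> nonneg_on V"
    using psd_bordered_bounds(2)
    by (auto simp: lift_body_def nonneg_on_def vecs_on_def diag_vec_def lifts_def mats_on_def)
  have lift_principal: "principal_part U F \<in> lifts V N K" if F: "F \<in> lifts V N K" for U F
    unfolding lifts_def
  proof (intro CollectI conjI ballI impI)
    show "principal_part U F \<in> mats_on V"
      using F by (auto simp: lifts_def mats_on_def principal_part_def)
    fix x assume x: "x \<in> V" "N x \<noteq> {}"
    show "restrict_vec (principal_part U F $ x) (N x) \<in> (*\<^sub>R) (principal_part U F $ x $ x) ` K x"
    proof (cases "x \<in> U")
      case True
      then have eq: "principal_part U F $ x = restrict_vec (F $ x) U"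
        "principal_part U F $ x $ x = F $ x $ x"
        by (auto simp: principal_part_def restrict_vec_def vec_eq_iff)
      obtain k where k: "k \<in> K x" "restrict_vec (F $ x) (N x) = F $ x $ x *\<^sub>R k"
        using F x by (auto simp: lifts_def)
      then have "restrict_vec (restrict_vec (F $ x) U) (N x) = F $ x $ x *\<^sub>R restrict_vec k U"
        by (subst restrict_vec_swap) (simp add: restrict_vec_scaleR)
      then have "restrict_vec (restrict_vec (F $ x) U) (N x) \<in> (*\<^sub>R) (F $ x $ x) ` K x"
        using K'(4)[OF x(1) k(1)] by blast
      then show ?thesis unfolding eq(2) unfolding eq(1) .
    next
      case False
      then have "principal_part U F $ x = 0" by (auto simp: principal_part_def vec_eq_iff)
      then show ?thesis using K'(3)[OF x(1)] by (force simp: restrict_vec_zero)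
    qed
  qed
  fix f U assume "f \<in> lift_body V N K"
  then obtain F where F: "F \<in> lifts V N K" "psd (bordered 1 F)" "f = diag_vec F"
    by (auto simp: lift_body_def)
  have "diag_vec (principal_part U F) = restrict_vec f U"
    by (auto simp: F(3) diag_vec_def principal_part_def restrict_vec_def vec_eq_iff)
  moreover have "psd (bordered 1 (principal_part U F))"
    using psd_principal_part[OF F(2)] by (simp add: bordered_principal_part)
  ultimately show "restrict_vec f U \<in> lift_body V N K"
    using lift_principal[OF F(1)] by (intro lift_bodyI)
next
  have "(0::real^'a^'a) \<in> lifts V N K"
    using K by (force simp: lifts_def mats_on_def restrict_vec_zero corner_body_def)
  moreover have "psd (bordered 1 (0::real^'a^'a))"
  proof -
    have "u \<bullet> (bordered 1 (0::real^'a^'a) *v u) = (u $ None)\<^sup>2" for u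
      by (simp add: quadratic_form_sum UNIV_option_conv sum.reindex bordered_def diag_vec_def
          power2_eq_square)
    then show ?thesis
      by (auto simp: psd_def transpose_def bordered_def diag_vec_def vec_eq_iff split: option.split)
  qed
  moreover have "diag_vec (0::real^'a^'a) = 0" by (simp add: diag_vec_def vec_eq_iff)
  ultimately show "0 \<in> lift_body V N K" by (rule lift_bodyI)
qed

text \<open>The witness is the matrix with a single one at \<open>(x, x)\<close>. As \<open>x\<close> is not in its own link, all
  restricted rows vanish, and the bordered matrix is the rank one matrix with factor \<open>p\<close>
  that is one exactly at the border and at \<open>x\<close>.\<close>

lemma axis_in_lift_body:
  assumes K: "\<And>x. x \<in> V \<Longrightarrow> 0 \<in> K x" and N: "\<And>x. x \<in> V \<Longrightarrow> x \<notin> N x" and x: "x \<in> V"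
  shows "axis x 1 \<in> lift_body V N K"
proof -
  define F :: "real^'a^'a" where "F = (\<chi> i j. if i = x \<and> j = x then 1 else 0)"
  have "F \<in> lifts V N K"
  proof -
    have "restrict_vec (F $ y) (N y) = 0" if "y \<in> V" for y
      using N that by (auto simp: restrict_vec_def F_def vec_eq_iff)
    moreover have "0 \<in> (*\<^sub>R) (F $ y $ y) ` K y" if "y \<in> V" for y
      using K[OF that] by (metis image_eqI scaleR_zero_right)
    ultimately show ?thesis using x by (auto simp: lifts_def mats_on_def F_def)
  qed
  moreover have "psd (bordered 1 F)"
  proof -
    define p :: "real^'a option" where "p = axis None 1 + axis (Some x) 1"
    have b: "bordered 1 F $ i $ j = p $ i * p $ j" for i j
      by (auto simp: bordered_def F_def diag_vec_def p_def axis_def split: option.split)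
    have "u \<bullet> (bordered 1 F *v u) = (u \<bullet> p)\<^sup>2" for u
    proof -
      have "(u \<bullet> p)\<^sup>2 = (\<Sum>i\<in>UNIV. \<Sum>j\<in>UNIV. (u $ i * p $ i) * (u $ j * p $ j))"
        by (simp only: power2_eq_square inner_vec_def inner_real_def sum_product)
      then show ?thesis
        unfolding quadratic_form_sum b by (simp only: mult.commute mult.left_commute mult.assoc)
    qed
    then show ?thesis by (auto simp: psd_def transpose_def vec_eq_iff b)
  qed
  moreover have "diag_vec F = axis x 1"
    by (auto simp: diag_vec_def F_def axis_def vec_eq_iff)
  ultimately show ?thesis by (rule lift_bodyI)
qed

text \<open>The scaling argument that turns the dual program into a gauge. The value \<open>l = 0\<close> cannot be
  rescaled, but there the diagonal is zero and both sides mean \<open>w = 0\<close>.\<close>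

lemma bordered_lift_iff_scaled_lift_body:
  assumes "0 \<in> lift_body V N K"
  shows "(\<exists>Z\<in>lifts V N K. diag_vec Z = w \<and> psd (bordered l Z)) \<longleftrightarrow>
    0 \<le> l \<and> w \<in> (*\<^sub>R) l ` lift_body V N K"
proof
  assume "\<exists>Z\<in>lifts V N K. diag_vec Z = w \<and> psd (bordered l Z)"
  then obtain Z where Z: "Z \<in> lifts V N K" "diag_vec Z = w" "psd (bordered l Z)" by auto
  have l: "0 \<le> l" using psd_bordered_bounds(1)[OF Z(3)] .
  show "0 \<le> l \<and> w \<in> (*\<^sub>R) l ` lift_body V N K"
  proof (cases "l = 0")
    case True
    then have "w = 0" using psd_bordered_bounds(3)[OF Z(3)] Z(2) by (auto simp: diag_vec_def vec_eq_iff)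
    then show ?thesis using True assms by force
  next
    case False
    have "bordered 1 ((1 / l) *\<^sub>R Z) = (1 / l) *\<^sub>R bordered l Z"
      using bordered_scaleR[of "1 / l" l Z] False by simp
    then have "diag_vec ((1 / l) *\<^sub>R Z) \<in> lift_body V N K"
      using Z l by (auto simp: lift_body_def intro!: imageI lifts_scaleR psd_scaleR)
    moreover have "w = l *\<^sub>R diag_vec ((1 / l) *\<^sub>R Z)"
      using False Z(2) by (simp add: linear_scale[OF linear_diag_vec])
    ultimately show ?thesis using l by blast
  qed
next
  assume "0 \<le> l \<and> w \<in> (*\<^sub>R) l ` lift_body V N K"
  then obtain F where l: "0 \<le> l" and F: "F \<in> lifts V N K" "psd (bordered 1 F)" "w = l *\<^sub>R diag_vec F"
    by (auto simp: lift_body_def)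
  have "l *\<^sub>R F \<in> lifts V N K" "diag_vec (l *\<^sub>R F) = w" "psd (bordered l (l *\<^sub>R F))"
    using F l psd_scaleR[OF F(2) l] bordered_scaleR[of l 1 F]
    by (auto simp: lifts_scaleR linear_scale[OF linear_diag_vec])
  then show "\<exists>Z\<in>lifts V N K. diag_vec Z = w \<and> psd (bordered l Z)" by blast
qed

section \<open>Theta bodies\<close>

lemma theta_body_eq_lift_body:
  "theta_body (Suc (Suc r)) H = lift_body (verts H) (link_verts H)
     (\<lambda>x. theta_body (Suc r) (link (Suc (Suc r)) H x))"
  by (auto simp: lift_body_def lifts_def vecs_on_def diag_vec_def mats_on_def)

lemma uniform_link: "uniform_hypergraph (r - 1) (link r H x)"
  for H :: "'v::finite hypergraph"
  by (auto simp: uniform_hypergraph_def link_def)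

text \<open>Independent sets are closed under subsets, and erasing coordinates is linear, so it maps the
  convex hull of their characteristic vectors into itself. Uniformity excludes the empty edge and
  thereby makes the empty set independent.\<close>

lemma corner_body_IND:
  fixes H :: "'v::finite hypergraph"
  assumes "uniform_hypergraph 1 H"
  shows "corner_body (verts H) (IND H)"
  unfolding corner_body_def
proof (intro conjI ballI allI)
  show "compact (IND H)"
    unfolding IND_def by (intro finite_imp_compact_convex_hull finite_imageI) simp
  show "convex (IND H)" by (simp add: IND_def)
  have "convex (nonneg_on (verts H))"
    by (auto simp: convex_def nonneg_on_def vecs_on_def)
  then show "IND H \<subseteq> nonneg_on (verts H)"
    unfolding IND_def
    by (intro hull_minimal) (auto simp: char_vec_def nonneg_on_def vecs_on_def independent_set_def)
  have "independent_set H {}"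
    using assms by (auto simp: independent_set_def uniform_hypergraph_def nsets_def)
  moreover have "char_vec {} = 0" by (simp add: char_vec_def vec_eq_iff)
  ultimately show "0 \<in> IND H"
    unfolding IND_def by (metis (mono_tags) hull_inc imageI mem_Collect_eq)
  fix f U assume "f \<in> IND H"
  have lin: "linear (\<lambda>f :: real ^ 'v. restrict_vec f U)"
    by (rule linearI) (auto simp: restrict_vec_add restrict_vec_scaleR)
  have "restrict_vec (char_vec I) U = char_vec (I \<inter> U)" for I :: "'v set"
    by (auto simp: restrict_vec_def char_vec_def vec_eq_iff)
  moreover have "independent_set H (I \<inter> U)" if "independent_set H I" for I
    using that by (auto simp: independent_set_def)
  ultimately have "(\<lambda>f. restrict_vec f U) ` char_vec ` {I. independent_set H I}
      \<subseteq> char_vec ` {I. independent_set H I}"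
    by auto
  then have "(\<lambda>f. restrict_vec f U) ` IND H \<subseteq> IND H"
    unfolding IND_def convex_hull_linear_image[OF lin] by (rule hull_mono)
  then show "restrict_vec f U \<in> IND H" using \<open>f \<in> IND H\<close> by blast
qed

lemma corner_body_theta_body:
  "uniform_hypergraph (Suc r) H \<Longrightarrow> corner_body (verts H) (theta_body (Suc r) H)"
proof (induction r arbitrary: H)
  case 0
  then show ?case using corner_body_IND[of H] by simp
next
  case (Suc r)
  have "corner_body (link_verts H x) (theta_body (Suc r) (link (Suc (Suc r)) H x))" for x
    using Suc.IH[of "link (Suc (Suc r)) H x"] uniform_link[of "Suc (Suc r)" H x]
    by (simp add: link_def)
  then show ?case unfolding theta_body_eq_lift_body by (intro corner_body_lift_body)
qed

text \<open>This fails at uniformity one, where a vertex that forms an edge lies in no independent set.\<close>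

lemma axis_in_theta_body:
  assumes "x \<in> verts H"
  shows "axis x 1 \<in> theta_body (Suc (Suc r)) H"
  unfolding theta_body_eq_lift_body
proof (rule axis_in_lift_body[OF _ _ assms])
  show "0 \<in> theta_body (Suc r) (link (Suc (Suc r)) H y)" for y
    using corner_body_theta_body[of r "link (Suc (Suc r)) H y"] uniform_link[of "Suc (Suc r)" H y]
    by (simp add: corner_body_def)
qed (simp add: link_verts_def)

lemma complement_complement:
  "uniform_hypergraph r H \<Longrightarrow> complement_hg r (complement_hg r H) = H"
  by (cases H) (auto simp: complement_hg_def uniform_hypergraph_def)

lemma theta_circ_eq_gauge:
  assumes "2 \<le> r"
  shows "theta_circ r H w = minkowski_gauge (theta_body r (complement_hg r H)) w"
proof -
  obtain k where r: "r = Suc (Suc k)" using assms by (metis add_2_eq_Suc le_Suc_ex)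
  let ?G = "complement_hg r H"
  have G: "verts ?G = verts H" "uniform_hypergraph r ?G"
    by (auto simp: complement_hg_def uniform_hypergraph_def)
  let ?K = "\<lambda>x. theta_body (Suc k) (link (Suc (Suc k)) ?G x)"
  have zero: "0 \<in> lift_body (verts ?G) (link_verts ?G) ?K"
    using corner_body_theta_body[of "Suc k" ?G] G(2)
    unfolding r theta_body_eq_lift_body by (simp add: corner_body_def)
  have "(\<exists>Z. theta_circ_feasible r H w l Z) \<longleftrightarrow>
      (\<exists>Z\<in>lifts (verts ?G) (link_verts ?G) ?K. diag_vec Z = w \<and> psd (bordered l Z))" for l
    unfolding theta_circ_feasible_def lifts_def G(1) by (auto simp: r)
  also have "\<dots> l \<longleftrightarrow> 0 \<le> l \<and> w \<in> (*\<^sub>R) l ` theta_body r ?G" for l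
    unfolding bordered_lift_iff_scaled_lift_body[OF zero] by (simp only: r theta_body_eq_lift_body)
  finally show ?thesis unfolding theta_circ_def minkowski_gauge_def by simp
qed

lemma theta_number_upper:
  assumes "2 \<le> r" "uniform_hypergraph r H" "f \<in> theta_body r H"
  shows "l \<bullet> f \<le> theta_number r H l"
proof -
  obtain k where r: "r = Suc k" using assms(1) by (cases r) auto
  have "compact (theta_body r H)"
    using corner_body_theta_body[of k H] assms r by (simp add: corner_body_def)
  then obtain m where m: "m \<in> theta_body r H" "\<And>h. h \<in> theta_body r H \<Longrightarrow> l \<bullet> h \<le> l \<bullet> m"
    using continuous_attains_sup[of "theta_body r H" "\<lambda>f. l \<bullet> f"] assms(3)
    by (force intro: continuous_intros)
  have "theta_number r H l = l \<bullet> m"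
    unfolding theta_number_def by (rule Greatest_equality) (use m in auto)
  then show ?thesis using m assms(3) by simp
qed

theorem theorem4p1:
  fixes r :: nat and H :: "('v::finite) hypergraph"
  assumes "r \<ge> 2" and "uniform_hypergraph r H"
  shows "(\<forall>w \<in> nonneg_on (verts H).
            (\<exists>g \<in> theta_circ_body r H. theta_circ r H w = w \<bullet> g) \<and>
            (\<forall>g \<in> theta_circ_body r H. w \<bullet> g \<le> theta_circ r H w))
       \<and> (\<forall>l \<in> nonneg_on (verts H). \<forall>w \<in> nonneg_on (verts H).
            theta_number r H l * theta_circ r (complement_hg r H) w \<ge> l \<bullet> w)
       \<and> antiblocker (verts H) (theta_body r H) = theta_circ_body r (complement_hg r H)"
proof -
  have verts_compl: "verts (complement_hg r G) = verts G" for G :: "'v hypergraph"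
    by (simp add: complement_hg_def)
  have body: "corner_body (verts G) (theta_body r G)"
    and axes: "\<And>x. x \<in> verts G \<Longrightarrow> axis x 1 \<in> theta_body r G"
    if "uniform_hypergraph r G" for G :: "'v hypergraph"
  proof -
    obtain k where r: "r = Suc (Suc k)" using assms by (metis add_2_eq_Suc le_Suc_ex)
    show "corner_body (verts G) (theta_body r G)"
      using corner_body_theta_body[of "Suc k" G] that r by simp
    show "\<And>x. x \<in> verts G \<Longrightarrow> axis x 1 \<in> theta_body r G"
      unfolding r by (rule axis_in_theta_body)
  qed
  have unif_compl: "uniform_hypergraph r (complement_hg r H)"
    using assms by (auto simp: complement_hg_def uniform_hypergraph_def)
  have circ_compl: "theta_circ r (complement_hg r H) w = minkowski_gauge (theta_body r H) w" for w
    by (simp add: theta_circ_eq_gauge[OF assms(1)] complement_complement[OF assms(2)])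
  have circ_body: "theta_circ_body r (complement_hg r G) = antiblocker (verts G) (theta_body r G)"
    if G: "uniform_hypergraph r G" for G :: "'v hypergraph"
    using antiblocker_eq_gauge_polar[OF body[OF G] axes[OF G]]
    by (simp add: theta_circ_body_def theta_circ_eq_gauge[OF assms(1)] complement_complement[OF G]
        verts_compl)
  have part1: "(\<exists>g \<in> theta_circ_body r H. theta_circ r H w = w \<bullet> g) \<and>
      (\<forall>g \<in> theta_circ_body r H. w \<bullet> g \<le> theta_circ r H w)" if w: "w \<in> nonneg_on (verts H)" for w
  proof
    show "\<exists>g \<in> theta_circ_body r H. theta_circ r H w = w \<bullet> g"
      using gauge_attained_on_antiblocker[OF body[OF unif_compl] axes[OF unif_compl]] w
        circ_body[OF unif_compl] complement_complement[OF assms(2)]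
      by (simp add: verts_compl theta_circ_eq_gauge[OF assms(1)])
    show "\<forall>g \<in> theta_circ_body r H. w \<bullet> g \<le> theta_circ r H w"
      using w by (simp add: theta_circ_body_def)
  qed
  have part2: "l \<bullet> w \<le> theta_number r H l * theta_circ r (complement_hg r H) w"
    if w: "w \<in> nonneg_on (verts H)" for l w
  proof -
    let ?m = "minkowski_gauge (theta_body r H) w"
    note m = minkowski_gauge_least[OF body[OF assms(2)] axes[OF assms(2)] w]
    obtain f where f: "f \<in> theta_body r H" "w = ?m *\<^sub>R f" using m(2) by auto
    have "l \<bullet> w = ?m * (l \<bullet> f)" by (subst f(2)) simp
    also have "\<dots> \<le> ?m * theta_number r H l"
      using theta_number_upper[OF assms f(1)] m(1) by (rule mult_left_mono)
    finally show ?thesis by (simp add: circ_compl mult.commute)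
  qed
  from part1 part2 circ_body[OF assms(2)] show ?thesis by simp
qed

end
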